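(* Let $r>0$ be a real number, let $m,n\in\mathbb{N}$, and let $P(\lambda)= I\lambda^m + A_{m-1}\lambda^{m-1} + \cdots + A_1\lambda + A_0$, where $I$ is the $n\times n$ identity matrix and $A_0,\dots,A_{m-1}$ are pairwise commuting $n\times n$ complex matrices, each of which has all its eigenvalues of modulus less than $r$. If $\lambda_0 \in \mathbb{C}$ is an eigenvalue of $P(\lambda)$, then $|\lambda_0| < r+1$.
   Context: $\mathbb{N}=\{1,2,3,\dots\}$. For a matrix polynomial $P(\lambda)=\sum_{i=0}^{m}A_i\lambda^i$ with $A_i\in M_n(\mathbb{C})$, a scalar $\lambda_0\in\mathbb{C}$ is an eigenvalue of $P(\lambda)$ if $P(\lambda_0)v=0$ for some nonzero vector $v\in\mathbb{C}^n$; equivalently, $\det P(\lambda_0)=0$. *)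

theory Defs
  imports "Jordan_Normal_Form.Char_Poly"
begin

text \<open>
  The matrix polynomial with coefficients \<open>A 0, \<dots>, A m\<close> (all of them \<open>n \<times> n\<close>), evaluated at the
  scalar \<open>x\<close>. The sum is taken in the additive group of \<open>n \<times> n\<close> matrices, since the type of
  matrices is not a monoid in the type-class sense.
\<close>

definition mat_poly_at :: "nat \<Rightarrow> nat \<Rightarrow> (nat \<Rightarrow> complex mat) \<Rightarrow> complex \<Rightarrow> complex mat" where
  "mat_poly_at n m A x = (\<Oplus>\<^bsub>module_mat TYPE(complex) n n\<^esub> i\<in>{..m}. x ^ i \<cdot>\<^sub>m A i)"

definition mat_poly_eigenvalue :: "nat \<Rightarrow> nat \<Rightarrow> (nat \<Rightarrow> complex mat) \<Rightarrow> complex \<Rightarrow> bool" where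
  "mat_poly_eigenvalue n m A x \<longleftrightarrow>
     (\<exists>v \<in> carrier_vec n. v \<noteq> 0\<^sub>v n \<and> mat_poly_at n m A x *\<^sub>v v = 0\<^sub>v n)"

lemma mat_poly_at_carrier:
  assumes "\<And>i. i \<le> m \<Longrightarrow> A i \<in> carrier_mat n n"
  shows "mat_poly_at n m A x \<in> carrier_mat n n"
proof -
  interpret abelian_group "module_mat TYPE(complex) n n" by (rule abelian_group_mat)
  show ?thesis
    using finsum_closed[of "\<lambda>i. x ^ i \<cdot>\<^sub>m A i" "{..m}"] assms
    by (auto simp: mat_poly_at_def module_mat_simps Pi_iff)
qed

lemma mat_poly_at_Suc:
  assumes "\<And>i. i \<le> Suc m \<Longrightarrow> A i \<in> carrier_mat n n"
  shows "mat_poly_at n (Suc m) A x = x ^ Suc m \<cdot>\<^sub>m A (Suc m) + mat_poly_at n m A x"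
proof -
  interpret abelian_group "module_mat TYPE(complex) n n" by (rule abelian_group_mat)
  show ?thesis
    using finsum_insert[of "{..m}" "Suc m" "\<lambda>i. x ^ i \<cdot>\<^sub>m A i"] assms
    by (auto simp: mat_poly_at_def module_mat_simps Pi_iff atMost_Suc)
qed

lemma mat_poly_at_0:
  assumes "A 0 \<in> carrier_mat n n"
  shows "mat_poly_at n 0 A x = A 0"
proof -
  interpret abelian_group "module_mat TYPE(complex) n n" by (rule abelian_group_mat)
  have "1 \<cdot>\<^sub>m A 0 = A 0" by auto
  then show ?thesis
    using finsum_insert[of "{}" 0 "\<lambda>i. x ^ i \<cdot>\<^sub>m A i"] assms
    by (auto simp: mat_poly_at_def module_mat_simps Pi_iff)
qed

lemma mat_poly_at_index:
  assumes "\<And>i. i \<le> m \<Longrightarrow> A i \<in> carrier_mat n n" and "a < n" "b < n"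
  shows "mat_poly_at n m A x $$ (a, b) = (\<Sum>i\<le>m. x ^ i * A i $$ (a, b))"
  using assms(1)
proof (induction m)
  case 0
  then show ?case by (simp add: mat_poly_at_0)
next
  case (Suc m)
  have c: "mat_poly_at n m A x \<in> carrier_mat n n" "A (Suc m) \<in> carrier_mat n n"
    using Suc.prems by (auto intro: mat_poly_at_carrier)
  show ?case
    using Suc c carrier_matD[OF c(2)] assms(2,3) by (simp add: mat_poly_at_Suc)
qed

lemma mat_poly_eigenvalue_iff_det:
  assumes "\<And>i. i \<le> m \<Longrightarrow> A i \<in> carrier_mat n n"
  shows "mat_poly_eigenvalue n m A x \<longleftrightarrow> det (mat_poly_at n m A x) = 0"
  using det_0_iff_vec_prod_zero[OF mat_poly_at_carrier[OF assms]]
  by (auto simp: mat_poly_eigenvalue_def)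

end

theory Submission
  imports Defs "HOL-Computational_Algebra.Fundamental_Theorem_Algebra"
begin

text \<open>
  Everything reduces to the scalar case, which is Cauchy's bound on the roots of a monic polynomial
  (\<open>monic_poly_root_bound\<close>).

  The coefficients commute with each other, hence with \<open>P(x)\<close>, so the kernel of \<open>P(x)\<close> is a nonzero
  subspace invariant under all of them. Over the complex numbers such a subspace contains a nonzero
  vector \<open>v\<close> that is an eigenvector of every coefficient at once
  (\<open>common_eigenvector_in_invariant_set\<close>), say \<open>A\<^sub>i v = a\<^sub>i v\<close>. Then
  \<open>0 = P(x) v = (x\<^sup>m + \<Sum> a\<^sub>i x\<^sup>i) v\<close>, so \<open>x\<close> is a root of a monic scalar polynomial whose other
  coefficients \<open>a\<^sub>i\<close> are eigenvalues of the \<open>A\<^sub>i\<close> and so have modulus less than \<open>r\<close>.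

  The kernel enters only as a set of vectors that is mapped into itself by \<open>w \<mapsto> A\<^sub>i w - c w\<close> for every
  scalar \<open>c\<close>. An eigenvector inside such a set is found without choosing a basis: for \<open>v \<noteq> 0\<close> there is
  a nonzero polynomial \<open>p\<close> with \<open>p(A) v = 0\<close>, because \<open>n + 1\<close> vectors in dimension \<open>n\<close> are dependent.
  Applying the linear factors of \<open>p\<close> to \<open>v\<close> one after the other must at some point turn a nonzero
  vector into zero, and that vector is an eigenvector.
\<close>

section \<open>Eigenvectors in invariant sets\<close>

text \<open>
  The scalars \<open>s i\<close> stand for one fixed entry of \<open>A\<^sup>i v\<close>; the left-hand side is then that entry of
  \<open>((X - c) q)(A) v\<close>, and the right-hand side that of \<open>q(A) (A v - c v)\<close>. The upper summation bounds
  are loose so that no degrees have to be computed.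
\<close>
lemma sum_coeff_linear_factor_mult:
  fixes q :: "'a :: comm_ring_1 poly" and s :: "nat \<Rightarrow> 'a"
  assumes "degree q \<le> N"
  shows "(\<Sum>i\<le>Suc N. coeff ([:- c, 1:] * q) i * s i) = (\<Sum>i\<le>N. coeff q i * (s (Suc i) - c * s i))"
proof -
  have z: "coeff q (Suc N) = 0" using assms by (simp add: coeff_eq_0)
  have "(\<Sum>i\<le>Suc N. coeff ([:- c, 1:] * q) i * s i)
      = (\<Sum>i\<le>Suc N. coeff (pCons 0 q) i * s i) - c * (\<Sum>i\<le>Suc N. coeff q i * s i)"
    by (simp add: sum_subtractf sum_distrib_left algebra_simps del: sum.atMost_Suc)
  also have "(\<Sum>i\<le>Suc N. coeff (pCons 0 q) i * s i) = (\<Sum>i\<le>N. coeff q i * s (Suc i))"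
    by (subst sum.atMost_Suc_shift) simp
  also have "(\<Sum>i\<le>Suc N. coeff q i * s i) = (\<Sum>i\<le>N. coeff q i * s i)"
    using z by simp
  finally show ?thesis
    by (simp add: sum_subtractf sum_distrib_left algebra_simps)
qed

text \<open>
  The \<open>n + 1\<close> vectors \<open>v, A v, \<dots>, A\<^sup>n v\<close> are dependent: padded with a zero row, the matrix with these
  columns becomes square and singular, and a kernel vector of it lists the coefficients of \<open>p\<close>.
\<close>
lemma exists_annihilating_poly:
  fixes A :: "'a :: field mat"
  assumes A: "A \<in> carrier_mat n n" and v: "v \<in> carrier_vec n"
  obtains p where "p \<noteq> 0" "degree p \<le> n"
    "\<And>j. j < n \<Longrightarrow> (\<Sum>i\<le>n. coeff p i * ((A ^\<^sub>m i) *\<^sub>v v) $ j) = 0"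
proof -
  define K where "K = mat (Suc n) (Suc n) (\<lambda>(j, i). if j < n then ((A ^\<^sub>m i) *\<^sub>v v) $ j else 0)"
  have K: "K \<in> carrier_mat (Suc n) (Suc n)" by (simp add: K_def)
  have "K = mat\<^sub>r (Suc n) (Suc n) (\<lambda>j. if j = n then 0\<^sub>v (Suc n) else row K j)"
    by (intro eq_matI) (auto simp: K_def)
  moreover have "row K \<in> {0..<Suc n} \<rightarrow> carrier_vec (Suc n)" using K by auto
  ultimately have "det K = 0" by (metis det_row_0 lessI)
  then obtain u where u: "u \<in> carrier_vec (Suc n)" "u \<noteq> 0\<^sub>v (Suc n)" "K *\<^sub>v u = 0\<^sub>v (Suc n)"
    using det_0_iff_vec_prod_zero[OF K] by auto
  define p where "p = Poly (list_of_vec u)"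
  have co: "coeff p i = u $ i" if "i \<le> n" for i
    using that u(1) by (auto simp: p_def nth_default_def list_of_vec_index)
  have co0: "coeff p i = 0" if "i > n" for i
    using that u(1) by (auto simp: p_def nth_default_def)
  have "p \<noteq> 0"
  proof
    assume "p = 0"
    then have "u = 0\<^sub>v (Suc n)" using co u(1) by (intro eq_vecI) (auto simp: less_Suc_eq_le)
    with u(2) show False by simp
  qed
  moreover have "degree p \<le> n" using co0 by (intro degree_le) auto
  moreover have "(\<Sum>i\<le>n. coeff p i * ((A ^\<^sub>m i) *\<^sub>v v) $ j) = 0" if "j < n" for j
  proof -
    have "0 = (K *\<^sub>v u) $ j" using u(3) that by simp
    also have "\<dots> = (\<Sum>i<Suc n. K $$ (j, i) * u $ i)"
      using K u(1) that by (auto simp: scalar_prod_def atLeast0LessThan intro!: sum.cong)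
    also have "\<dots> = (\<Sum>i\<le>n. coeff p i * ((A ^\<^sub>m i) *\<^sub>v v) $ j)"
      unfolding lessThan_Suc_atMost using that by (intro sum.cong) (auto simp: K_def co)
    finally show ?thesis by simp
  qed
  ultimately show ?thesis using that by blast
qed

text \<open>
  Induction on the degree of \<open>p\<close>: if \<open>p = (X - c) q\<close>, then either \<open>A v = c v\<close> and \<open>v\<close> is the desired
  eigenvector, or \<open>A v - c v\<close> is a nonzero element of \<open>W\<close> annihilated by \<open>q(A)\<close>.
\<close>
lemma eigenvector_from_annihilating_poly:
  fixes A :: "complex mat"
  assumes A: "A \<in> carrier_mat n n" and W: "W \<subseteq> carrier_vec n"
    and inv: "\<And>w c. w \<in> W \<Longrightarrow> A *\<^sub>v w - c \<cdot>\<^sub>v w \<in> W"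
    and "v \<in> W" "v \<noteq> 0\<^sub>v n" "p \<noteq> 0" "degree p \<le> N"
    and "\<And>j. j < n \<Longrightarrow> (\<Sum>i\<le>N. coeff p i * ((A ^\<^sub>m i) *\<^sub>v v) $ j) = 0"
  shows "\<exists>w\<in>W. w \<noteq> 0\<^sub>v n \<and> (\<exists>c. A *\<^sub>v w = c \<cdot>\<^sub>v w)"
  using assms(4-)
proof (induction N arbitrary: v p)
  case 0
  have v: "v \<in> carrier_vec n" using W 0 by auto
  have "coeff p 0 \<noteq> 0" using 0 by (metis le_0_eq leading_coeff_0_iff)
  then have "v $ j = 0" if "j < n" for j
    using 0(5)[OF that] A v by simp
  then have "v = 0\<^sub>v n" using v by (intro eq_vecI) auto
  with 0 show ?case by simp
next
  case (Suc N)
  have v: "v \<in> carrier_vec n" using W Suc by auto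
  show ?case
  proof (cases "degree p = 0")
    case True
    then have z: "coeff p (Suc i) = 0" for i by (simp add: coeff_eq_0)
    have "(\<Sum>i\<le>N. coeff p i * ((A ^\<^sub>m i) *\<^sub>v v) $ j) = 0" if "j < n" for j
      using Suc.prems(5)[OF that] z by simp
    then show ?thesis using Suc.IH[of v p] Suc.prems True by simp
  next
    case False
    then obtain c where "poly p c = 0"
      using fundamental_theorem_of_algebra[of p] by (auto simp: constant_degree)
    then obtain q where q: "p = [:- c, 1:] * q" by (auto simp: poly_eq_0_iff_dvd)
    have q0: "q \<noteq> 0" using q Suc.prems by auto
    have "degree p = Suc (degree q)" 
      unfolding q using q0 by (subst degree_mult_eq) (auto simp del: mult_pCons_left)
    then have dq: "degree q \<le> N" using Suc.prems by simp
    define w where "w = A *\<^sub>v v - c \<cdot>\<^sub>v v"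
    have wW: "w \<in> W" using inv Suc.prems by (simp add: w_def)
    have "(\<Sum>i\<le>N. coeff q i * ((A ^\<^sub>m i) *\<^sub>v w) $ j) = 0" if j: "j < n" for j
    proof -
      have "((A ^\<^sub>m i) *\<^sub>v w) $ j = ((A ^\<^sub>m Suc i) *\<^sub>v v) $ j - c * ((A ^\<^sub>m i) *\<^sub>v v) $ j" for i
      proof -
        have Ai: "A ^\<^sub>m i \<in> carrier_mat n n" using A by simp
        have "(A ^\<^sub>m i) *\<^sub>v w = (A ^\<^sub>m i) *\<^sub>v (A *\<^sub>v v) - (A ^\<^sub>m i) *\<^sub>v (c \<cdot>\<^sub>v v)"
          unfolding w_def by (rule mult_minus_distrib_mat_vec[OF Ai]) (use A v in auto)
        also have "(A ^\<^sub>m i) *\<^sub>v (A *\<^sub>v v) = (A ^\<^sub>m Suc i) *\<^sub>v v"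
          using assoc_mult_mat_vec[OF Ai A v] by simp
        also have "(A ^\<^sub>m i) *\<^sub>v (c \<cdot>\<^sub>v v) = c \<cdot>\<^sub>v ((A ^\<^sub>m i) *\<^sub>v v)"
          by (rule mult_mat_vec[OF Ai v])
        finally show ?thesis using j Ai A v
          by (simp del: index_mult_mat_vec pow_mat.simps)
      qed
      then show ?thesis
        using sum_coeff_linear_factor_mult[OF dq, of c "\<lambda>i. ((A ^\<^sub>m i) *\<^sub>v v) $ j"]
          Suc.prems(5)[OF j] q by simp
    qed
    note next_vector = Suc.IH[OF wW _ q0 dq this]
    show ?thesis
    proof (cases "w = 0\<^sub>v n")
      case True
      have "A *\<^sub>v v = c \<cdot>\<^sub>v v"
      proof (rule eq_vecI)
        fix j assume "j < dim_vec (c \<cdot>\<^sub>v v)"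
        then have "j < n" using v by simp
        moreover from this have "w $ j = 0" using True by simp
        ultimately show "(A *\<^sub>v v) $ j = (c \<cdot>\<^sub>v v) $ j" using A v by (simp add: w_def)
      qed (use A v in auto)
      then show ?thesis using Suc.prems by blast
    next
      case False
      then show ?thesis using next_vector by blast
    qed
  qed
qed

lemma eigenvector_in_invariant_set:
  fixes A :: "complex mat"
  assumes "A \<in> carrier_mat n n" "W \<subseteq> carrier_vec n"
    and "\<And>w c. w \<in> W \<Longrightarrow> A *\<^sub>v w - c \<cdot>\<^sub>v w \<in> W" and "v \<in> W" "v \<noteq> 0\<^sub>v n"
  obtains w c where "w \<in> W" "w \<noteq> 0\<^sub>v n" "A *\<^sub>v w = c \<cdot>\<^sub>v w"
proof -
  have v: "v \<in> carrier_vec n" using assms by auto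
  obtain p where p: "p \<noteq> 0" "degree p \<le> n"
    "\<And>j. j < n \<Longrightarrow> (\<Sum>i\<le>n. coeff p i * ((A ^\<^sub>m i) *\<^sub>v v) $ j) = 0"
    using exists_annihilating_poly[OF assms(1) v] by blast
  show ?thesis
    using eigenvector_from_annihilating_poly[OF assms p] that by blast
qed

text \<open>
  The source of all invariant sets used here: for \<open>B = P(x)\<close> and \<open>b = 0\<close> it shows that the kernel of
  \<open>P(x)\<close> is invariant under the coefficients, and for \<open>B\<close> a coefficient it lets the search for a common
  eigenvector continue inside an eigenspace of \<open>B\<close>.
\<close>
lemma commuting_preserves_eigenspace:
  fixes A B :: "'a :: field mat"
  assumes A: "A \<in> carrier_mat n n" and B: "B \<in> carrier_mat n n" and comm: "A * B = B * A"
    and w: "w \<in> carrier_vec n" and eig: "B *\<^sub>v w = b \<cdot>\<^sub>v w"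
  shows "B *\<^sub>v (A *\<^sub>v w - c \<cdot>\<^sub>v w) = b \<cdot>\<^sub>v (A *\<^sub>v w - c \<cdot>\<^sub>v w)"
proof -
  have "B *\<^sub>v (A *\<^sub>v w - c \<cdot>\<^sub>v w) = B *\<^sub>v (A *\<^sub>v w) - B *\<^sub>v (c \<cdot>\<^sub>v w)"
    by (rule mult_minus_distrib_mat_vec[OF B]) (use A w in auto)
  also have "B *\<^sub>v (A *\<^sub>v w) = A *\<^sub>v (B *\<^sub>v w)"
    using assoc_mult_mat_vec[OF A B w] assoc_mult_mat_vec[OF B A w] comm by simp
  also have "\<dots> = b \<cdot>\<^sub>v (A *\<^sub>v w)"
    unfolding eig by (rule mult_mat_vec[OF A w])
  also have "B *\<^sub>v (c \<cdot>\<^sub>v w) = c \<cdot>\<^sub>v (b \<cdot>\<^sub>v w)"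
    using mult_mat_vec[OF B w] eig by simp
  also have "b \<cdot>\<^sub>v (A *\<^sub>v w) - c \<cdot>\<^sub>v (b \<cdot>\<^sub>v w) = b \<cdot>\<^sub>v (A *\<^sub>v w - c \<cdot>\<^sub>v w)"
    using A w by (intro eq_vecI) (auto simp: algebra_simps)
  finally show ?thesis .
qed

text \<open>
  Induction on the number of matrices. An eigenspace of the last matrix inside \<open>W\<close> is again preserved
  by the remaining ones, since they commute with it, so the induction hypothesis applies to that
  smaller set.
\<close>
lemma common_eigenvector_in_invariant_set:
  fixes A :: "nat \<Rightarrow> complex mat"
  assumes "\<And>i. i < k \<Longrightarrow> A i \<in> carrier_mat n n"
    and "\<And>i j. i < k \<Longrightarrow> j < k \<Longrightarrow> A i * A j = A j * A i"
    and "W \<subseteq> carrier_vec n"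
    and "\<And>i w c. i < k \<Longrightarrow> w \<in> W \<Longrightarrow> A i *\<^sub>v w - c \<cdot>\<^sub>v w \<in> W"
    and "v \<in> W" "v \<noteq> 0\<^sub>v n"
  shows "\<exists>w\<in>W. w \<noteq> 0\<^sub>v n \<and> (\<forall>i<k. \<exists>c. A i *\<^sub>v w = c \<cdot>\<^sub>v w)"
  using assms
proof (induction k arbitrary: W v)
  case 0
  then show ?case by auto
next
  case (Suc k)
  obtain w c where w: "w \<in> W" "w \<noteq> 0\<^sub>v n" "A k *\<^sub>v w = c \<cdot>\<^sub>v w"
    using eigenvector_in_invariant_set[of "A k" n W v] Suc.prems by (metis lessI)
  define E where "E = {u \<in> W. A k *\<^sub>v u = c \<cdot>\<^sub>v u}"
  have "\<exists>u\<in>E. u \<noteq> 0\<^sub>v n \<and> (\<forall>i<k. \<exists>c. A i *\<^sub>v u = c \<cdot>\<^sub>v u)"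
  proof (rule Suc.IH[where v = w])
    fix i u d assume i: "i < k" and u: "u \<in> E"
    then have "A k *\<^sub>v (A i *\<^sub>v u - d \<cdot>\<^sub>v u) = c \<cdot>\<^sub>v (A i *\<^sub>v u - d \<cdot>\<^sub>v u)"
      using Suc.prems(1-3) by (intro commuting_preserves_eigenspace) (auto simp: E_def)
    then show "A i *\<^sub>v u - d \<cdot>\<^sub>v u \<in> E" using Suc.prems(4) i u by (simp add: E_def)
  qed (use Suc.prems w in \<open>auto simp: E_def\<close>)
  then show ?case by (auto simp: E_def less_Suc_eq)
qed

section \<open>Evaluated matrix polynomials\<close>

lemma mat_poly_at_commute:
  assumes B: "B \<in> carrier_mat n n"
    and "\<And>i. i \<le> m \<Longrightarrow> A i \<in> carrier_mat n n" "\<And>i. i \<le> m \<Longrightarrow> B * A i = A i * B"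
  shows "B * mat_poly_at n m A x = mat_poly_at n m A x * B"
  using assms(2-)
proof (induction m)
  case 0
  then show ?case by (simp add: mat_poly_at_0)
next
  case (Suc m)
  let ?S = "x ^ Suc m \<cdot>\<^sub>m A (Suc m)"
  have c: "mat_poly_at n m A x \<in> carrier_mat n n" and a: "A (Suc m) \<in> carrier_mat n n"
    using Suc.prems by (auto intro: mat_poly_at_carrier)
  have S: "?S \<in> carrier_mat n n" using a by simp
  have "B * ?S = ?S * B"
    using Suc.prems(2) mult_smult_distrib[OF B a] mult_smult_assoc_mat[OF a B] by simp
  moreover have "B * mat_poly_at n m A x = mat_poly_at n m A x * B" using Suc by simp
  moreover have "mat_poly_at n (Suc m) A x = ?S + mat_poly_at n m A x"
    by (rule mat_poly_at_Suc) (rule Suc.prems(1))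
  ultimately show ?case
    by (simp only: mult_add_distrib_mat[OF B S c] add_mult_distrib_mat[OF S c B])
qed

lemma mat_poly_at_common_eigenvector:
  assumes v: "v \<in> carrier_vec n"
    and "\<And>i. i \<le> m \<Longrightarrow> A i \<in> carrier_mat n n" "\<And>i. i \<le> m \<Longrightarrow> A i *\<^sub>v v = a i \<cdot>\<^sub>v v"
  shows "mat_poly_at n m A x *\<^sub>v v = (\<Sum>i\<le>m. a i * x ^ i) \<cdot>\<^sub>v v"
  using assms(2-)
proof (induction m)
  case 0
  then show ?case by (simp add: mat_poly_at_0)
next
  case (Suc m)
  let ?S = "x ^ Suc m \<cdot>\<^sub>m A (Suc m)"
  have c: "mat_poly_at n m A x \<in> carrier_mat n n" and S: "?S \<in> carrier_mat n n"
    and a: "A (Suc m) \<in> carrier_mat n n"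
    using Suc.prems by (auto intro: mat_poly_at_carrier)
  have "?S *\<^sub>v v = x ^ Suc m \<cdot>\<^sub>v (A (Suc m) *\<^sub>v v)"
    using a v by (intro eq_vecI) auto
  moreover have "mat_poly_at n m A x *\<^sub>v v = (\<Sum>i\<le>m. a i * x ^ i) \<cdot>\<^sub>v v" using Suc by simp
  moreover have "mat_poly_at n (Suc m) A x = ?S + mat_poly_at n m A x"
    by (rule mat_poly_at_Suc) (rule Suc.prems(1))
  ultimately show ?case
    using Suc.prems(2)[of "Suc m"] v add_mult_distrib_mat_vec[OF S c v]
    by (intro eq_vecI) (auto simp: algebra_simps)
qed

section \<open>The bound\<close>

text \<open>
  Cauchy's bound. If \<open>\<bar>x\<bar> \<ge> r + 1\<close>, then
  \<open>\<bar>x\<bar>\<^sup>m \<le> r (1 + \<bar>x\<bar> + \<dots> + \<bar>x\<bar>\<^sup>m\<^sup>-\<^sup>1) \<le> (\<bar>x\<bar> - 1) (1 + \<bar>x\<bar> + \<dots> + \<bar>x\<bar>\<^sup>m\<^sup>-\<^sup>1) = \<bar>x\<bar>\<^sup>m - 1\<close>.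
\<close>
lemma monic_poly_root_bound:
  fixes x :: "'a :: real_normed_field"
  assumes "\<And>i. i < m \<Longrightarrow> norm (a i) \<le> r" and root: "x ^ m + (\<Sum>i<m. a i * x ^ i) = 0"
  shows "norm x < r + 1"
proof (rule ccontr)
  assume "\<not> norm x < r + 1"
  then have le: "r \<le> norm x - 1" by simp
  have "norm x ^ m = norm (\<Sum>i<m. a i * x ^ i)"
    using root by (metis add_eq_0_iff2 norm_minus_cancel norm_power)
  also have "\<dots> \<le> (\<Sum>i<m. (norm x - 1) * norm x ^ i)"
    using assms(1) le
    by (intro sum_norm_le) (auto simp: norm_mult norm_power intro!: mult_right_mono intro: order_trans)
  also have "\<dots> = norm x ^ m - 1"
    by (simp add: power_diff_1_eq sum_distrib_left)
  finally show False by simp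
qed

theorem theorem2p6:
  fixes r :: real and m n :: nat and A :: "nat \<Rightarrow> complex mat" and x :: complex
  assumes "r > 0" and "m \<ge> 1" and "n \<ge> 1"
    and "\<And>i. i < m \<Longrightarrow> A i \<in> carrier_mat n n"
    and "\<And>i j. i < m \<Longrightarrow> j < m \<Longrightarrow> A i * A j = A j * A i"
    and "\<And>i k. i < m \<Longrightarrow> eigenvalue (A i) k \<Longrightarrow> cmod k < r"
    and "mat_poly_eigenvalue n m (A(m := 1\<^sub>m n)) x"
  shows "cmod x < r + 1"
proof -
  let ?A = "A(m := 1\<^sub>m n)"
  let ?P = "mat_poly_at n m ?A x"
  have car: "?A i \<in> carrier_mat n n" if "i \<le> m" for i
    using assms(4) that by auto
  have P: "?P \<in> carrier_mat n n" by (rule mat_poly_at_carrier) (rule car)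
  have comm: "A i * ?P = ?P * A i" if i: "i < m" for i
  proof (rule mat_poly_at_commute)
    fix j assume "j \<le> m"
    then show "A i * ?A j = ?A j * A i"
      using assms(4)[OF i] assms(5)[OF i, of j] by (cases "j = m") auto
  qed (use assms(4) i car in auto)
  define W where "W = {w \<in> carrier_vec n. ?P *\<^sub>v w = 0 \<cdot>\<^sub>v w}"
  obtain u where "u \<in> carrier_vec n" and u0: "u \<noteq> 0\<^sub>v n" and "?P *\<^sub>v u = 0\<^sub>v n"
    using assms(7) by (auto simp: mat_poly_eigenvalue_def)
  then have u: "u \<in> W" by (auto simp: W_def)
  have "\<exists>w\<in>W. w \<noteq> 0\<^sub>v n \<and> (\<forall>i<m. \<exists>c. A i *\<^sub>v w = c \<cdot>\<^sub>v w)"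
  proof (rule common_eigenvector_in_invariant_set)
    fix i w c assume i: "i < m" and w: "w \<in> W"
    have "?P *\<^sub>v (A i *\<^sub>v w - c \<cdot>\<^sub>v w) = 0 \<cdot>\<^sub>v (A i *\<^sub>v w - c \<cdot>\<^sub>v w)"
      by (rule commuting_preserves_eigenspace[OF assms(4)[OF i] P comm[OF i]])
        (use w in \<open>auto simp: W_def\<close>)
    then show "A i *\<^sub>v w - c \<cdot>\<^sub>v w \<in> W"
      using assms(4)[OF i] w by (simp add: W_def)
  qed (use assms u u0 in \<open>auto simp: W_def\<close>)
  then obtain v a where v: "v \<in> W" "v \<noteq> 0\<^sub>v n" and a: "\<And>i. i < m \<Longrightarrow> A i *\<^sub>v v = a i \<cdot>\<^sub>v v"
    by metis
  have vc: "v \<in> carrier_vec n" using v by (simp add: W_def)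
  let ?a = "a(m := 1)"
  have "?A i *\<^sub>v v = ?a i \<cdot>\<^sub>v v" if "i \<le> m" for i
    using that a vc by auto
  then have "?P *\<^sub>v v = (\<Sum>i\<le>m. ?a i * x ^ i) \<cdot>\<^sub>v v"
    by (intro mat_poly_at_common_eigenvector[OF vc car])
  then have "(\<Sum>i\<le>m. ?a i * x ^ i) \<cdot>\<^sub>v v = 0 \<cdot>\<^sub>v v"
    using v(1) unfolding W_def by (metis (mono_tags, lifting) mem_Collect_eq)
  moreover obtain j where "j < n" "v $ j \<noteq> 0"
    using v(2) vc by (metis carrier_vecD eq_vecI index_zero_vec)
  ultimately have "(\<Sum>i\<le>m. ?a i * x ^ i) = 0"
    using vc by (metis carrier_vecD index_smult_vec(1) mult_right_cancel)
  then have "x ^ m + (\<Sum>i<m. a i * x ^ i) = 0"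
    by (simp add: lessThan_Suc_atMost[symmetric] add.commute)
  moreover have "cmod (a i) \<le> r" if "i < m" for i
  proof -
    have "eigenvalue (A i) (a i)"
      using a[OF that] v(2) vc assms(4)[OF that]
      by (auto simp: eigenvalue_def eigenvector_def)
    then show ?thesis using assms(6)[OF that] by (simp add: less_imp_le)
  qed
  ultimately show ?thesis by (intro monic_poly_root_bound)
qed

end
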